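(* Let $(W,S)$ be a Coxeter system, let $(X,\mathrm{ht})$ be a quasiparabolic $W$-set and let $x\in X$. Let $w=s_1\cdots s_k\in W$ (with $s_1,\dots,s_k\in S$) be an arbitrary (not necessarily reduced) word, and let $r\in R(W)$. If $\mathrm{ht}(rx)>\mathrm{ht}(x)$ and $\mathrm{ht}(wrx)<\mathrm{ht}(wx)$, then there exists $1\le i\le k$ such that $wrx=s_1\cdots s_{i-1}s_{i+1}\cdots s_k x$.
   Context: Coxeter systems $(W,S)$ have finite rank; $R(W)$ is the set of reflections, i.e. conjugates in $W$ of elements of $S$. A scaled $W$-set is a pair $(X,\mathrm{ht})$ with $X$ a (left) $W$-set and $\mathrm{ht}:X\to\mathbb Z$ a function with $|\mathrm{ht}(sx)-\mathrm{ht}(x)|\le 1$ for all $s\in S$, $x\in X$. A quasiparabolic $W$-set is a scaled $W$-set such that (QP1) for all $r\in R(W)$, $x\in X$, if $\mathrm{ht}(rx)=\mathrm{ht}(x)$ then $rx=x$; and (QP2) for all $r\in R(W)$, $x\in X$, $s\in S$, if $\mathrm{ht}(rx)>\mathrm{ht}(x)$ and $\mathrm{ht}(srx)<\mathrm{ht}(sx)$, then $rx=sx$. *)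

theory Defs
  imports "HOL-Algebra.Group_Action" "HOL-Algebra.Generated_Groups"
begin

section \<open>Group presentations\<close>

text \<open>A letter \<open>(a, True)\<close> stands for the generator \<open>a\<close> and \<open>(a, False)\<close> for its formal inverse.\<close>

type_synonym 'a group_word = "('a \<times> bool) list"

definition words_over :: "'a set \<Rightarrow> 'a group_word set"
  where "words_over A = {u. fst ` set u \<subseteq> A}"

text \<open>Equality of words in the group presented by generators \<open>A\<close> and relators \<open>R\<close>.\<close>

inductive pres_eq :: "'a set \<Rightarrow> 'a group_word set \<Rightarrow> 'a group_word \<Rightarrow> 'a group_word \<Rightarrow> bool"
  for A R
  where
    refl: "u \<in> words_over A \<Longrightarrow> pres_eq A R u u"
  | sym: "pres_eq A R u v \<Longrightarrow> pres_eq A R v u"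
  | trans: "pres_eq A R u v \<Longrightarrow> pres_eq A R v w \<Longrightarrow> pres_eq A R u w"
  | cancel: "u \<in> words_over A \<Longrightarrow> v \<in> words_over A \<Longrightarrow> a \<in> A
      \<Longrightarrow> pres_eq A R (u @ [(a, e), (a, \<not> e)] @ v) (u @ v)"
  | relator: "u \<in> words_over A \<Longrightarrow> v \<in> words_over A \<Longrightarrow> r \<in> R
      \<Longrightarrow> pres_eq A R (u @ r @ v) (u @ v)"

definition list_prod :: "('a, 'b) monoid_scheme \<Rightarrow> 'a list \<Rightarrow> 'a"
  where "list_prod G xs = foldr (mult G) xs (one G)"

definition word_value :: "('a, 'b) monoid_scheme \<Rightarrow> 'a group_word \<Rightarrow> 'a"
  where "word_value G u = list_prod G (map (\<lambda>(a, e). if e then a else m_inv G a) u)"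

text \<open>The canonical map from the presented group to \<open>G\<close> is well defined and injective
  (last conjunct) and surjective.\<close>

definition has_presentation ::
  "('a, 'b) monoid_scheme \<Rightarrow> 'a set \<Rightarrow> 'a group_word set \<Rightarrow> bool"
  where "has_presentation G A R \<longleftrightarrow>
    A \<subseteq> carrier G \<and> R \<subseteq> words_over A \<and> generate G A = carrier G \<and>
    (\<forall>u \<in> words_over A. \<forall>v \<in> words_over A.
       word_value G u = word_value G v \<longleftrightarrow> pres_eq A R u v)"

section \<open>Coxeter systems\<close>

text \<open>The value \<open>0\<close> encodes the entry \<open>\<infinity>\<close>, i.e. the absence of a relation.\<close>

definition coxeter_matrix :: "'a set \<Rightarrow> ('a \<Rightarrow> 'a \<Rightarrow> nat) \<Rightarrow> bool"
  where "coxeter_matrix S m \<longleftrightarrow>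
    (\<forall>s \<in> S. \<forall>t \<in> S. m s t = m t s \<and> (m s t = 1 \<longleftrightarrow> s = t))"

definition coxeter_relators :: "'a set \<Rightarrow> ('a \<Rightarrow> 'a \<Rightarrow> nat) \<Rightarrow> 'a group_word set"
  where "coxeter_relators S m =
    {concat (replicate (m s t) [(s, True), (t, True)]) | s t. s \<in> S \<and> t \<in> S \<and> m s t \<noteq> 0}"

locale coxeter_system = group W for W (structure) +
  fixes S :: "'a set"
  assumes finite_rank: "finite S"
    and presentation: "\<exists>m. coxeter_matrix S m \<and> has_presentation W S (coxeter_relators S m)"

definition reflections :: "('a, 'b) monoid_scheme \<Rightarrow> 'a set \<Rightarrow> 'a set"
  where "reflections W S = {w \<otimes>\<^bsub>W\<^esub> s \<otimes>\<^bsub>W\<^esub> inv\<^bsub>W\<^esub> w | w s. w \<in> carrier W \<and> s \<in> S}"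

section \<open>Quasiparabolic sets\<close>

locale scaled_W_set = coxeter_system W S + group_action W X act
  for W (structure) and S and X :: "'x set" and act +
  fixes ht :: "'x \<Rightarrow> int"
  assumes scaled: "\<lbrakk>s \<in> S; x \<in> X\<rbrakk> \<Longrightarrow> \<bar>ht (act s x) - ht x\<bar> \<le> 1"

locale quasiparabolic_W_set = scaled_W_set +
  assumes QP1: "\<lbrakk>r \<in> reflections W S; x \<in> X; ht (act r x) = ht x\<rbrakk> \<Longrightarrow> act r x = x"
    and QP2: "\<lbrakk>r \<in> reflections W S; x \<in> X; s \<in> S;
      ht (act r x) > ht x; ht (act s (act r x)) < ht (act s x)\<rbrakk> \<Longrightarrow> act r x = act s x"

end

theory Submission
  imports Defs
begin

text \<open>Write \<open>w = s v\<close> and induct on the word. If \<open>v\<close> already reverses the order of the heights of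
  \<open>r x\<close> and \<open>x\<close>, the induction hypothesis deletes a letter of \<open>v\<close>. Otherwise (QP1) excludes equality,
  and (QP2), applied to \<open>v x\<close> and the reflection \<open>v r v\<^sup>-\<^sup>1\<close>, shows \<open>v r x = s v x\<close>, so that
  \<open>w r x = v x\<close>: the first letter is deleted.\<close>

lemma list_prod_Nil [simp]: "list_prod G [] = \<one>\<^bsub>G\<^esub>"
  by (simp add: list_prod_def)

lemma list_prod_Cons [simp]: "list_prod G (a # as) = a \<otimes>\<^bsub>G\<^esub> list_prod G as"
  by (simp add: list_prod_def)

lemma (in monoid) list_prod_closed: "set as \<subseteq> carrier G \<Longrightarrow> list_prod G as \<in> carrier G"
  by (induction as) auto

context coxeter_system
begin

lemma generators_closed: "S \<subseteq> carrier W"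
  using presentation by (auto simp: has_presentation_def)

text \<open>The diagonal entry \<open>m s s = 1\<close> makes the two-letter word \<open>s s\<close>
  itself a relator, and equality in the presentation forces equal values in
  \<open>W\<close>.\<close>

lemma generator_square:
  assumes "s \<in> S"
  shows "s \<otimes> s = \<one>"
proof -
  obtain m where m: "coxeter_matrix S m" "has_presentation W S (coxeter_relators S m)"
    using presentation by blast
  have "m s s = 1"
    using m(1) assms by (simp add: coxeter_matrix_def)
  then have "[(s, True), (s, True)] \<in> coxeter_relators S m"
    using assms by (auto simp: coxeter_relators_def intro!: exI[of _ s])
  then have "pres_eq S (coxeter_relators S m) ([] @ [(s, True), (s, True)] @ []) ([] @ [])"
    by (intro pres_eq.relator) (auto simp: words_over_def)
  then have "word_value W [(s, True), (s, True)] = word_value W []"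
    using m(2) assms by (simp add: has_presentation_def words_over_def)
  then show ?thesis
    using assms generators_closed by (auto simp: word_value_def)
qed

lemma reflections_closed: "reflections W S \<subseteq> carrier W"
  using generators_closed by (auto simp: reflections_def)

text \<open>This lets (QP1) and (QP2) be applied at a translate \<open>v x\<close> instead of
  \<open>x\<close>. The conjugator \<open>u\<close> of \<open>r\<close> is replaced by
  \<open>v u\<close>.\<close>

lemma conjugate_reflection:
  assumes "r \<in> reflections W S" "v \<in> carrier W"
  shows "v \<otimes> r \<otimes> inv v \<in> reflections W S"
proof -
  obtain u s where us: "u \<in> carrier W" "s \<in> S" "r = u \<otimes> s \<otimes> inv u"
    using assms(1) by (auto simp: reflections_def)
  have "s \<in> carrier W"
    using us(2) generators_closed by blast
  then have "v \<otimes> r \<otimes> inv v = (v \<otimes> u) \<otimes> s \<otimes> inv (v \<otimes> u)"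
    using us assms(2) by (simp add: inv_mult_group m_assoc)
  then show ?thesis
    unfolding reflections_def using us assms(2) by blast
qed

end

context quasiparabolic_W_set
begin

lemma act_generator_twice:
  assumes "s \<in> S" "x \<in> X"
  shows "act s (act s x) = x"
proof -
  have "act s (act s x) = act (s \<otimes> s) x"
    using assms generators_closed composition_rule[of x s s] by auto
  \<comment> \<open>The unit acts as the identity restricted to \<open>X\<close>, so membership of
    \<open>x\<close> in \<open>X\<close> is needed here.\<close>
  also have "\<dots> = x"
    using assms generator_square id_eq_one by (metis restrict_apply')
  finally show ?thesis .
qed

lemma strong_exchange:
  assumes x: "x \<in> X" and r: "r \<in> reflections W S"
    and up: "ht (act r x) > ht x"
  shows "\<lbrakk>set ss \<subseteq> S; ht (act (list_prod W ss) (act r x)) < ht (act (list_prod W ss) x)\<rbrakk>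
    \<Longrightarrow> \<exists>i \<in> {1..length ss}. act (list_prod W ss) (act r x)
      = act (list_prod W (take (i - 1) ss @ drop i ss)) x"
proof (induction ss)
  case Nil
  \<comment> \<open>The empty word acts trivially, so the assumed drop in height contradicts
    \<open>up\<close>.\<close>
  have "act \<one> y = y" if "y \<in> X" for y
    using that id_eq_one by (metis restrict_apply')
  moreover have "act r x \<in> X"
    using x r reflections_closed element_image[of r x] by blast
  ultimately show ?case
    using Nil.prems x up by simp
next
  case (Cons s ss)
  let ?v = "list_prod W ss"
  have s: "s \<in> S" "s \<in> carrier W" and ss: "set ss \<subseteq> S" "set ss \<subseteq> carrier W"
    using Cons.prems(1) generators_closed by auto
  have v: "?v \<in> carrier W"
    by (rule list_prod_closed[OF ss(2)])
  have rc: "r \<in> carrier W"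
    using r reflections_closed by blast
  have rx: "act r x \<in> X" and vx: "act ?v x \<in> X"
    using x rc v element_image by blast+
  have split: "act (s \<otimes> u) y = act s (act u y)" if "u \<in> carrier W" "y \<in> X" for u y
    using that s composition_rule by blast
  have down: "ht (act s (act ?v (act r x))) < ht (act s (act ?v x))"
    using Cons.prems(2) split v x rx by simp
  let ?r = "?v \<otimes> r \<otimes> inv ?v"
  \<comment> \<open>The conjugate reflection moves \<open>v x\<close> to \<open>v r x\<close>; hence
    the quasiparabolic axioms at \<open>v x\<close> compare exactly these two points.\<close>
  have conj: "act ?r (act ?v x) = act ?v (act r x)"
  proof -
    have "act ?r (act ?v x) = act (?r \<otimes> ?v) x"
      using v rc x composition_rule by simp
    also have "?r \<otimes> ?v = ?v \<otimes> r"
      using v rc by (simp add: m_assoc)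
    finally show ?thesis
      using v rc x composition_rule by simp
  qed
  have refl: "?r \<in> reflections W S"
    by (rule conjugate_reflection[OF r v])
  consider "ht (act ?v (act r x)) < ht (act ?v x)" | "ht (act ?v (act r x)) = ht (act ?v x)"
    | "ht (act ?v (act r x)) > ht (act ?v x)"
    by linarith
  then show ?case
  proof cases
    case 1
    then obtain i where i: "i \<in> {1..length ss}"
      "act ?v (act r x) = act (list_prod W (take (i - 1) ss @ drop i ss)) x"
      using Cons.IH[OF ss(1)] by blast
    have "list_prod W (take (i - 1) ss @ drop i ss) \<in> carrier W"
      using ss(2) set_take_subset[of "i - 1" ss] set_drop_subset[of i ss]
      by (intro list_prod_closed) auto
    then have "act (list_prod W (s # ss)) (act r x)
        = act (list_prod W (s # take (i - 1) ss @ drop i ss)) x"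
      using i(2) split v x rx by simp
    \<comment> \<open>Positions count from 1, so prepending \<open>s\<close> shifts the deleted
      position to \<open>Suc i\<close>. The bound \<open>i \<ge> 1\<close> matters because
      subtraction on naturals truncates at 0.\<close>
    moreover have "s # take (i - 1) ss @ drop i ss
        = take (Suc i - 1) (s # ss) @ drop (Suc i) (s # ss)"
      using i(1) by (cases i) auto
    ultimately have "act (list_prod W (s # ss)) (act r x)
        = act (list_prod W (take (Suc i - 1) (s # ss) @ drop (Suc i) (s # ss))) x"
      by (simp only:)
    moreover have "Suc i \<in> {1..length (s # ss)}"
      using i(1) by simp
    ultimately show ?thesis
      by (rule bexI)
  next
    case 2
    \<comment> \<open>Once the two points coincide, so do their images under \<open>s\<close>,
      against the strict inequality \<open>down\<close>.\<close>
    then have "act ?v (act r x) = act ?v x"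
      using QP1[OF refl vx] conj by simp
    then show ?thesis
      using down by simp
  next
    case 3
    then have "act ?v (act r x) = act s (act ?v x)"
      using QP2[OF refl vx s(1)] conj down by simp
    \<comment> \<open>The two copies of \<open>s\<close> cancel, which leaves the word without its
      leading letter: position 1.\<close>
    then have "act (list_prod W (s # ss)) (act r x) = act ?v x"
      using split v rx act_generator_twice[OF s(1) vx] by simp
    then show ?thesis
      by (intro bexI[of _ 1]) auto
  qed
qed

end

theorem theorem2p5:
  fixes W :: "('a, 'b) monoid_scheme" and S :: "'a set"
    and X :: "'x set" and act :: "'a \<Rightarrow> 'x \<Rightarrow> 'x" and ht :: "'x \<Rightarrow> int"
    and x :: 'x and ss :: "'a list" and w r :: 'a
  assumes "coxeter_system W S"
    and "quasiparabolic_W_set W S X act ht"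
    and "x \<in> X"
    and "set ss \<subseteq> S" and "w = list_prod W ss"
    and "r \<in> reflections W S"
    and "ht (act r x) > ht x"
    and "ht (act w (act r x)) < ht (act w x)"
  shows "\<exists>i \<in> {1..length ss}.
    act w (act r x) = act (list_prod W (take (i - 1) ss @ drop i ss)) x"
  using quasiparabolic_W_set.strong_exchange[OF assms(2,3,6,7,4)] assms(5,8) by simp

end
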